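(* Let $\Pi\subset\mathbb{R}^2$ be a square with side length $R>0$, and let $f:\Pi\to\mathbb{R}$ be a convex differentiable function such that for all $x,y\in\Pi$: 1) $|f(x)-f(y)|\le L\|x-y\|$, 2) $\|\nabla f(x)-\nabla f(y)\|\le M\|x-y\|$. Let $\varepsilon>0$, and suppose that the constant $L$ is chosen so that $$n=\log_2\frac{2LR\sqrt2}{\varepsilon}$$ is a natural number. Let $$\delta=\frac{\varepsilon}{2MR\,(\sqrt2+\sqrt5)\left(1-\dfrac{\varepsilon}{LR\sqrt2}\right)},$$ where the denominator is assumed to be nonzero (so that $\delta$ is defined). Then, after $n$ iterations of Nesterov's method on the square (defined in the context) started from $K_0=\Pi$, with all auxiliary one-dimensional problems solved with accuracy $\delta$ with respect to the argument, the resulting square $K_n\subset\Pi$ satisfies $$f(x)-\min_{y\in\Pi}f(y)\le\varepsilon\qquad\text{for all }x\in K_n .$$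
   Context: Norm and inner product on $\mathbb{R}^2$ are the standard Euclidean ones. The square $\Pi$ is a closed square with sides parallel to the coordinate axes; "horizontal" and "vertical" refer to the directions of its sides. At boundary points of $\Pi$ differentiability and the gradient are understood relative to $\Pi$. Nesterov's method on the square. Start from $K_0=\Pi$. Given a closed square $K_{i-1}$, one iteration (step) of the method produces a closed square $K_i\subset K_{i-1}$ of half the side length as follows. (a) Draw the horizontal line through the center of $K_{i-1}$ and let $l$ be the segment it cuts out of $K_{i-1}$; $l$ divides $K_{i-1}$ into two closed rectangles. Solve the auxiliary one-dimensional problem of minimizing $f$ over $l$ with accuracy $\delta$ with respect to the argument, i.e. obtain a point $x_\delta\in l$ such that $\|x_\delta-x_0\|\le\delta$ for some minimizer $x_0$ of $f$ on $l$. Compute the gradient $\nabla f(x_\delta)$ and determine towards which of the two rectangles it points (that is, look at the sign of its component orthogonal to $l$). The rectangle towards which $\nabla f(x_\delta)$ points is discarded and the other rectangle is kept. (b) Draw the vertical line through the center of the remaining rectangle and let $l'$ be the segment it cuts out of that rectangle; $l'$ divides the rectangle into two closed squares. In the same way, obtain a point $x'_\delta\in l'$ at distance at most $\delta$ from some minimizer of $f$ on $l'$, compute $\nabla f(x'_\delta)$, discard the square towards which this gradient points, and let $K_i$ be the other square. If a computed gradient is nonzero but directed along the segment (its component orthogonal to the segment is zero), either of the two parts may be discarded, chosen arbitrarily. If a computed gradient is zero, the method may stop and return the corresponding point, which is then an exact minimizer of $f$ on $\Pi$; the claim concerns any run in which $n$ iterations are carried out and the square $K_n$ is produced. The method is not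 required to choose approximate points or arbitrary parts in any particular way: the claim holds for every admissible choice. *)

theory Defs
  imports "HOL-Analysis.Analysis"
begin

(* Coordinate 1 is horizontal and coordinate 2 is vertical; a is the lower left corner. *)
definition axis_square :: "real^2 \<Rightarrow> real \<Rightarrow> (real^2) set" where
  "axis_square a s = cbox a (\<chi> i. a $ i + s)"

(* The part of the rectangle cbox a b on the line through its center orthogonal to the
   k-th axis, and the two closed halves into which this segment divides the rectangle. *)
definition mid_segment :: "2 \<Rightarrow> real^2 \<Rightarrow> real^2 \<Rightarrow> (real^2) set" where
  "mid_segment k a b = {x \<in> cbox a b. x $ k = (a $ k + b $ k) / 2}"

definition lower_half :: "2 \<Rightarrow> real^2 \<Rightarrow> real^2 \<Rightarrow> (real^2) set" where
  "lower_half k a b = {x \<in> cbox a b. x $ k \<le> (a $ k + b $ k) / 2}"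

definition upper_half :: "2 \<Rightarrow> real^2 \<Rightarrow> real^2 \<Rightarrow> (real^2) set" where
  "upper_half k a b = {x \<in> cbox a b. x $ k \<ge> (a $ k + b $ k) / 2}"

definition approx_minimizer ::
  "(real^2 \<Rightarrow> real) \<Rightarrow> real \<Rightarrow> (real^2) set \<Rightarrow> real^2 \<Rightarrow> bool" where
  "approx_minimizer f \<delta> l p \<longleftrightarrow>
     p \<in> l \<and> (\<exists>x0. is_arg_min f (\<lambda>x. x \<in> l) x0 \<and> norm (p - x0) \<le> \<delta>)"

(* One bisection, where g is the gradient field of f: the half towards which g p points is
   discarded. If the k-th component of g p vanishes, both rules apply, so either half may be
   kept; this includes g p = 0, for a run that goes on although it could have stopped. *)
inductive bisect ::
  "(real^2 \<Rightarrow> real) \<Rightarrow> (real^2 \<Rightarrow> real^2) \<Rightarrow> real \<Rightarrow> 2 \<Rightarrow> (real^2) set \<Rightarrow> (real^2) set \<Rightarrow> bool"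
  for f g \<delta> k where
  keep_lower: "approx_minimizer f \<delta> (mid_segment k a b) p \<Longrightarrow> g p $ k \<ge> 0 \<Longrightarrow>
     bisect f g \<delta> k (cbox a b) (lower_half k a b)"
| keep_upper: "approx_minimizer f \<delta> (mid_segment k a b) p \<Longrightarrow> g p $ k \<le> 0 \<Longrightarrow>
     bisect f g \<delta> k (cbox a b) (upper_half k a b)"

definition nesterov_step ::
  "(real^2 \<Rightarrow> real) \<Rightarrow> (real^2 \<Rightarrow> real^2) \<Rightarrow> real \<Rightarrow> (real^2) set \<Rightarrow> (real^2) set \<Rightarrow> bool" where
  "nesterov_step f g \<delta> K K' \<longleftrightarrow> (\<exists>H. bisect f g \<delta> 2 K H \<and> bisect f g \<delta> 1 H K')"

definition nesterov_run ::
  "(real^2 \<Rightarrow> real) \<Rightarrow> (real^2 \<Rightarrow> real^2) \<Rightarrow> real \<Rightarrow> (real^2) set \<Rightarrow> nat \<Rightarrow> (nat \<Rightarrow> (real^2) set) \<Rightarrow> bool"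
  where
  "nesterov_run f g \<delta> S n K \<longleftrightarrow>
     K 0 = S \<and> (\<forall>i<n. nesterov_step f g \<delta> (K i) (K (Suc i)))"

end

theory Submission
  imports Defs
begin

text \<open>
  Why the theorem holds. Suppose a box is cut by a segment on which \<open>f\<close> has the minimizer
  \<open>x0\<close>. If the gradient at \<open>x0\<close> itself were used, cutting would lose nothing: by the convexity
  inequality \<open>f y \<ge> f x0 + grad x0 \<bullet> (y - x0)\<close> every discarded point \<open>y\<close> satisfies
  \<open>f y \<ge> f x0\<close>, since the part of \<open>y - x0\<close> along the segment contributes at least \<open>0\<close> by
  optimality of \<open>x0\<close> (which may be an endpoint), and the part orthogonal to it contributes at
  least \<open>0\<close> by the choice of the discarded half. Moreover \<open>x0\<close> survives in the kept half. With
  a point \<open>p\<close> at distance at most \<open>\<delta>\<close> from \<open>x0\<close> the gradient is off by at most \<open>M * \<delta>\<close>, so the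
  value lost is at most \<open>M * \<delta>\<close> times the distance from \<open>y\<close> to the segment
  (\<open>cut_loss\<close>, \<open>bisect_box\<close>).

  Both cuts of a step on a square of side \<open>s\<close> thus lose at most \<open>M * \<delta> * (s / 2)\<close> each
  (\<open>nesterov_step_square\<close>), and the geometric series over the sides \<open>R, R/2, R/4, \<dots>\<close> bounds
  the total loss after \<open>n\<close> steps by \<open>2 * M * \<delta> * R * (1 - 1/2^n)\<close> (\<open>nesterov_run_square\<close>). The
  choice of \<open>\<delta>\<close> makes this at most \<open>\<epsilon> / 2\<close>. The other \<open>\<epsilon> / 2\<close> is
  the oscillation of \<open>f\<close> on \<open>K n\<close>, which is at most \<open>L\<close> times the diagonal \<open>sqrt 2 * R / 2^n\<close>.
\<close>

section \<open>First-order conditions for convex functions relative to a convex set\<close>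

lemma directional_derivative_within_convex:
  fixes f :: "'a::real_normed_vector \<Rightarrow> real"
  assumes "convex S" "x \<in> S" "y \<in> S" and f: "(f has_derivative D) (at x within S)"
  shows "((\<lambda>t. (f (x + t *\<^sub>R (y - x)) - f x) / t) \<longlongrightarrow> D (y - x)) (at_right 0)"
proof -
  define u where "u = (\<lambda>t::real. x + t *\<^sub>R (y - x))"
  have u_in: "u t \<in> S" if "t \<in> {0..1}" for t
  proof -
    have "u t = (1 - t) *\<^sub>R x + t *\<^sub>R y" by (simp add: u_def algebra_simps)
    then show ?thesis using assms that by (auto simp: convex_alt)
  qed
  have u: "(u has_derivative (\<lambda>t. t *\<^sub>R (y - x))) (at 0 within {0..1})"
    unfolding u_def by (auto intro!: derivative_eq_intros)
  have "(f has_derivative D) (at (u 0) within u ` {0..1})"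
    using f u_in by (auto simp: u_def intro: has_derivative_subset)
  from diff_chain_within[OF u this]
  have "((\<lambda>t. f (u t)) has_derivative (\<lambda>t. D (t *\<^sub>R (y - x)))) (at 0 within {0..1})"
    by (simp add: o_def)
  moreover have "D (t *\<^sub>R (y - x)) = D (y - x) * t" for t
    using linear_cmul[OF has_derivative_linear[OF f]] by simp
  ultimately have "((\<lambda>t. f (u t)) has_real_derivative D (y - x)) (at 0 within {0..1})"
    by (simp add: has_field_derivative_def)
  then have "((\<lambda>t. (f (u t) - f (u 0)) / (t - 0)) \<longlongrightarrow> D (y - x)) (at 0 within {0..1})"
    by (simp add: has_field_derivative_iff)
  then show ?thesis
    by (simp add: u_def at_within_Icc_at_right)
qed

lemma convex_on_above_tangent:
  fixes f :: "'a::real_normed_vector \<Rightarrow> real"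
  assumes cf: "convex_on S f" and "x \<in> S" "y \<in> S" and "(f has_derivative D) (at x within S)"
  shows "f x + D (y - x) \<le> f y"
proof -
  have "convex S" using cf by (rule convex_on_imp_convex)
  have "(f (x + t *\<^sub>R (y - x)) - f x) / t \<le> f y - f x" if "0 < t" "t < 1" for t
  proof -
    have "x + t *\<^sub>R (y - x) = (1 - t) *\<^sub>R x + t *\<^sub>R y" by (simp add: algebra_simps)
    then have "f (x + t *\<^sub>R (y - x)) \<le> (1 - t) * f x + t * f y"
      using convex_onD[OF cf, of t x y] assms that by simp
    then have "f (x + t *\<^sub>R (y - x)) - f x \<le> (f y - f x) * t" by (simp add: algebra_simps)
    then show ?thesis using that by (simp only: pos_divide_le_eq)
  qed
  then have "eventually (\<lambda>t. (f (x + t *\<^sub>R (y - x)) - f x) / t \<le> f y - f x) (at_right 0)"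
    by (auto simp: eventually_at_right[of 0 1] intro!: exI[of _ 1])
  then have "D (y - x) \<le> f y - f x"
    using tendsto_upperbound[OF directional_derivative_within_convex[OF \<open>convex S\<close> assms(2-4)]]
    by simp
  then show ?thesis by simp
qed

lemma minimizer_on_convex_derivative_nonneg:
  fixes f :: "'a::real_normed_vector \<Rightarrow> real"
  assumes "convex T" and min: "is_arg_min f (\<lambda>x. x \<in> T) x" and "w \<in> T"
    and "(f has_derivative D) (at x within T)"
  shows "0 \<le> D (w - x)"
proof -
  have x: "x \<in> T" and le: "\<And>z. z \<in> T \<Longrightarrow> f x \<le> f z"
    using min by (auto simp: is_arg_min_linorder)
  have "0 \<le> (f (x + t *\<^sub>R (w - x)) - f x) / t" if "0 < t" "t < 1" for t
  proof -
    have "x + t *\<^sub>R (w - x) = (1 - t) *\<^sub>R x + t *\<^sub>R w" by (simp add: algebra_simps)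
    then have "x + t *\<^sub>R (w - x) \<in> T"
      using assms x that by (auto simp: convex_alt)
    then show ?thesis using le that by simp
  qed
  then have "eventually (\<lambda>t. 0 \<le> (f (x + t *\<^sub>R (w - x)) - f x) / t) (at_right 0)"
    by (auto simp: eventually_at_right[of 0 1] intro!: exI[of _ 1])
  then show ?thesis
    using tendsto_lowerbound[OF directional_derivative_within_convex[OF \<open>convex T\<close> x assms(3,4)]]
    by simp
qed

section \<open>The loss caused by a cut\<close>

text \<open>
  The displacement from \<open>x0\<close> to \<open>y\<close> is split at a point \<open>w\<close> of \<open>T\<close>: the part inside \<open>T\<close> is
  harmless by optimality of \<open>x0\<close>, and on the part from \<open>w\<close> to \<open>y\<close> the gradient \<open>d\<close> at \<open>x0\<close> is
  compared with the vector \<open>v\<close>, the gradient computed at the approximate minimizer.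
\<close>
lemma cut_loss:
  fixes f :: "'a::real_inner \<Rightarrow> real"
  assumes cf: "convex_on S f"
    and df: "(f has_derivative (\<lambda>h. d \<bullet> h)) (at x0 within S)"
    and T: "convex T" "T \<subseteq> S" and min: "is_arg_min f (\<lambda>x. x \<in> T) x0"
    and "w \<in> T" "y \<in> S" and v: "0 \<le> v \<bullet> (y - w)" "norm (v - d) \<le> \<eta>"
  shows "f x0 \<le> f y + \<eta> * norm (y - w)"
proof -
  have x0: "x0 \<in> S" using min T by (auto simp: is_arg_min_def)
  have "0 \<le> d \<bullet> (w - x0)"
    using minimizer_on_convex_derivative_nonneg[OF T(1) min \<open>w \<in> T\<close>] has_derivative_subset[OF df T(2)]
    by blast
  moreover have "f x0 + d \<bullet> (y - x0) \<le> f y"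
    using convex_on_above_tangent[OF cf x0 \<open>y \<in> S\<close> df] .
  moreover have "d \<bullet> (y - x0) = v \<bullet> (y - w) - (v - d) \<bullet> (y - w) + d \<bullet> (w - x0)"
    by (simp add: inner_diff)
  moreover have "(v - d) \<bullet> (y - w) \<le> \<eta> * norm (y - w)"
    using norm_cauchy_schwarz[of "v - d" "y - w"] mult_right_mono[OF v(2), of "norm (y - w)"]
    by simp
  ultimately show ?thesis using v(1) by linarith
qed

lemma convex_mid_segment: "convex (mid_segment k a b)"
proof -
  have "mid_segment k a b = cbox a b \<inter> {x. axis k 1 \<bullet> x = (a $ k + b $ k) / 2}"
    by (auto simp: mid_segment_def inner_axis')
  then show ?thesis by (metis convex_Int convex_box(1) convex_hyperplane)
qed

lemma lower_half_eq_cbox: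
  assumes "a $ k \<le> b $ k"
  shows "lower_half k a b = cbox a (\<chi> i. if i = k then (a $ k + b $ k) / 2 else b $ i)"
proof (intro set_eqI iffI)
  fix x assume "x \<in> lower_half k a b"
  then show "x \<in> cbox a (\<chi> i. if i = k then (a $ k + b $ k) / 2 else b $ i)"
    by (auto simp: lower_half_def mem_box_cart)
next
  fix x assume x: "x \<in> cbox a (\<chi> i. if i = k then (a $ k + b $ k) / 2 else b $ i)"
  have k: "x $ k \<le> (a $ k + b $ k) / 2"
    using x by (auto simp: mem_box_cart dest: spec[of _ k])
  have "x $ i \<le> b $ i" for i
    using x k assms by (cases "i = k") (auto simp: mem_box_cart dest: spec[of _ i])
  then show "x \<in> lower_half k a b"
    using x k by (auto simp: lower_half_def mem_box_cart)
qed

lemma upper_half_eq_cbox: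
  assumes "a $ k \<le> b $ k"
  shows "upper_half k a b = cbox (\<chi> i. if i = k then (a $ k + b $ k) / 2 else a $ i) b"
proof (intro set_eqI iffI)
  fix x assume "x \<in> upper_half k a b"
  then show "x \<in> cbox (\<chi> i. if i = k then (a $ k + b $ k) / 2 else a $ i) b"
    by (auto simp: upper_half_def mem_box_cart)
next
  fix x assume x: "x \<in> cbox (\<chi> i. if i = k then (a $ k + b $ k) / 2 else a $ i) b"
  have k: "(a $ k + b $ k) / 2 \<le> x $ k"
    using x by (auto simp: mem_box_cart dest: spec[of _ k])
  have "a $ i \<le> x $ i" for i
    using x k assms by (cases "i = k") (auto simp: mem_box_cart dest: spec[of _ i])
  then show "x \<in> upper_half k a b"
    using x k by (auto simp: upper_half_def mem_box_cart)
qed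

text \<open>
  A nonempty box determines its corners, so a cut of \<open>cbox a b\<close> is made along the middle of
  \<open>a\<close> and \<open>b\<close>.
\<close>
lemma bisect_cboxE:
  assumes "bisect f g \<delta> k (cbox a b) H"
  obtains p where "approx_minimizer f \<delta> (mid_segment k a b) p"
    and "H = lower_half k a b \<and> 0 \<le> g p $ k \<or> H = upper_half k a b \<and> g p $ k \<le> 0"
proof -
  obtain a' b' p where ab': "cbox a b = cbox a' b'"
    and p: "approx_minimizer f \<delta> (mid_segment k a' b') p"
    and H: "H = lower_half k a' b' \<and> 0 \<le> g p $ k \<or> H = upper_half k a' b' \<and> g p $ k \<le> 0"
    using assms by cases blast+
  have "cbox a' b' \<noteq> {}"
    using p by (auto simp: approx_minimizer_def mid_segment_def)
  then have "a' = a" "b' = b" using ab' eq_cbox[of a b a' b'] by auto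
  then show ?thesis using that p H by blast
qed

lemma bisect_box:
  fixes f :: "real^2 \<Rightarrow> real" and g :: "real^2 \<Rightarrow> real^2"
  assumes cf: "convex_on S f"
    and df: "\<And>x. x \<in> S \<Longrightarrow> (f has_derivative (\<lambda>h. g x \<bullet> h)) (at x within S)"
    and lip: "\<And>x y. x \<in> S \<Longrightarrow> y \<in> S \<Longrightarrow> norm (g x - g y) \<le> M * norm (x - y)"
    and "0 \<le> M" and sub: "cbox a b \<subseteq> S"
    and bi: "bisect f g \<delta> k (cbox a b) H"
  obtains a' b' where "H = cbox a' b'" and "H \<subseteq> cbox a b"
    and "\<And>i. b' $ i - a' $ i = (if i = k then (b $ k - a $ k) / 2 else b $ i - a $ i)"
    and "\<And>y. y \<in> cbox a b \<Longrightarrow> \<exists>z\<in>H. f z \<le> f y + M * \<delta> * ((b $ k - a $ k) / 2)"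
proof -
  define m where "m = (a $ k + b $ k) / 2"
  from bi obtain p where p: "approx_minimizer f \<delta> (mid_segment k a b) p"
    and H: "H = lower_half k a b \<and> 0 \<le> g p $ k \<or> H = upper_half k a b \<and> g p $ k \<le> 0"
    by (rule bisect_cboxE)
  from p obtain x0 where pl: "p \<in> mid_segment k a b"
    and min: "is_arg_min f (\<lambda>x. x \<in> mid_segment k a b) x0" and px0: "norm (p - x0) \<le> \<delta>"
    by (auto simp: approx_minimizer_def)
  have x0l: "x0 \<in> mid_segment k a b" using min by (simp add: is_arg_min_def)
  have lS: "mid_segment k a b \<subseteq> S" using sub by (auto simp: mid_segment_def)
  have "a $ k \<le> p $ k" "p $ k \<le> b $ k" using pl by (auto simp: mid_segment_def mem_box_cart)
  then have ab: "a $ k \<le> b $ k" by linarith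
  have "norm (g p - g x0) \<le> M * norm (p - x0)" using lip pl x0l lS by blast
  also have "\<dots> \<le> M * \<delta>" using px0 \<open>0 \<le> M\<close> by (rule mult_left_mono)
  finally have gp: "norm (g p - g x0) \<le> M * \<delta>" .
  have "0 \<le> M * \<delta>" using norm_ge_zero gp by (rule order_trans)
  have x0H: "x0 \<in> H"
    using H x0l by (auto simp: mid_segment_def lower_half_def upper_half_def)
  have HK: "H \<subseteq> cbox a b" using H by (auto simp: lower_half_def upper_half_def)
  have loss: "\<exists>z\<in>H. f z \<le> f y + M * \<delta> * ((b $ k - a $ k) / 2)" if y: "y \<in> cbox a b" for y
  proof (cases "y \<in> H")
    case True
    then show ?thesis using \<open>0 \<le> M * \<delta>\<close> ab by (auto intro!: bexI[of _ y])
  next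
    case False
    \<comment> \<open>the orthogonal projection of \<open>y\<close> onto the segment\<close>
    define w where "w = y + axis k (m - y $ k)"
    have yw: "y - w = axis k (y $ k - m)"
      by (auto simp: w_def vec_eq_iff axis_def)
    have wl: "w \<in> mid_segment k a b"
      using y ab by (auto simp: mid_segment_def w_def m_def mem_box_cart axis_def)
    have "0 \<le> g p $ k * (y $ k - m)"
      using H y False
      by (auto simp: lower_half_def upper_half_def m_def intro: mult_nonneg_nonneg mult_nonpos_nonpos)
    then have "0 \<le> g p \<bullet> (y - w)" by (simp add: yw inner_axis)
    then have "f x0 \<le> f y + M * \<delta> * norm (y - w)"
      using cut_loss[OF cf df convex_mid_segment lS min wl _ _ gp] x0l lS y sub by blast
    moreover have "norm (y - w) \<le> (b $ k - a $ k) / 2"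
    proof -
      have "a $ k \<le> y $ k" "y $ k \<le> b $ k" using y by (auto simp: mem_box_cart)
      then have "\<bar>y $ k - m\<bar> \<le> (b $ k - a $ k) / 2" by (simp add: m_def abs_le_iff field_simps)
      moreover have "axis k t = t *\<^sub>R axis k (1::real)" for t
        by (simp add: vec_eq_iff axis_def)
      ultimately show ?thesis by (metis yw norm_scaleR norm_axis_1 mult_1_right)
    qed
    ultimately have "f x0 \<le> f y + M * \<delta> * ((b $ k - a $ k) / 2)"
      using mult_left_mono[OF _ \<open>0 \<le> M * \<delta>\<close>, of "norm (y - w)" "(b $ k - a $ k) / 2"] by linarith
    then show ?thesis using x0H by blast
  qed
  from H show ?thesis
  proof (elim disjE conjE)
    assume Hl: "H = lower_half k a b"
    show ?thesis
      by (rule that[OF _ HK _ loss], subst Hl, rule lower_half_eq_cbox[OF ab])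
        (auto simp: field_simps)
  next
    assume Hu: "H = upper_half k a b"
    show ?thesis
      by (rule that[OF _ HK _ loss], subst Hu, rule upper_half_eq_cbox[OF ab])
        (auto simp: field_simps)
  qed
qed

section \<open>Steps and runs of the method\<close>

lemma nesterov_step_square:
  fixes f :: "real^2 \<Rightarrow> real" and g :: "real^2 \<Rightarrow> real^2"
  assumes cf: "convex_on S f"
    and df: "\<And>x. x \<in> S \<Longrightarrow> (f has_derivative (\<lambda>h. g x \<bullet> h)) (at x within S)"
    and lip: "\<And>x y. x \<in> S \<Longrightarrow> y \<in> S \<Longrightarrow> norm (g x - g y) \<le> M * norm (x - y)"
    and M: "0 \<le> M" and sub: "axis_square a s \<subseteq> S"
    and step: "nesterov_step f g \<delta> (axis_square a s) K'"
  obtains c where "K' = axis_square c (s / 2)" and "K' \<subseteq> axis_square a s"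
    and "\<And>y. y \<in> axis_square a s \<Longrightarrow> \<exists>z\<in>K'. f z \<le> f y + M * \<delta> * s"
proof -
  define b where "b = (\<chi> i. a $ i + s)"
  have sq: "axis_square a s = cbox a b" by (simp add: axis_square_def b_def)
  from step obtain H where H: "bisect f g \<delta> 2 (cbox a b) H" and K': "bisect f g \<delta> 1 H K'"
    by (auto simp: nesterov_step_def sq)
  obtain a1 b1 where H_eq: "H = cbox a1 b1" and HK: "H \<subseteq> cbox a b"
    and side1: "\<And>i. b1 $ i - a1 $ i = (if i = 2 then (b $ 2 - a $ 2) / 2 else b $ i - a $ i)"
    and loss1: "\<And>y. y \<in> cbox a b \<Longrightarrow> \<exists>z\<in>H. f z \<le> f y + M * \<delta> * ((b $ 2 - a $ 2) / 2)"
    using bisect_box[OF cf df lip M sub[unfolded sq] H] by blast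
  have "cbox a1 b1 \<subseteq> S" using HK sub by (auto simp: H_eq sq)
  then obtain a2 b2 where K'_eq: "K' = cbox a2 b2" and K'H: "K' \<subseteq> H"
    and side2: "\<And>i. b2 $ i - a2 $ i = (if i = 1 then (b1 $ 1 - a1 $ 1) / 2 else b1 $ i - a1 $ i)"
    and loss2: "\<And>y. y \<in> H \<Longrightarrow> \<exists>z\<in>K'. f z \<le> f y + M * \<delta> * ((b1 $ 1 - a1 $ 1) / 2)"
    using bisect_box[OF cf df lip M _ K'[unfolded H_eq]] unfolding H_eq by blast
  have ss: "b $ i - a $ i = s" for i by (simp add: b_def)
  have one_two: "(1::2) \<noteq> 2" by simp
  have s1: "b1 $ 1 - a1 $ 1 = s" by (simp add: side1 ss one_two)
  have s2: "b2 $ i - a2 $ i = s / 2" for i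
    using exhaust_2[of i] by (auto simp: side1 side2 ss one_two)
  have "b2 = (\<chi> i. a2 $ i + s / 2)"
  proof (rule vec_eq_iff[THEN iffD2], rule allI)
    fix i show "b2 $ i = (\<chi> i. a2 $ i + s / 2) $ i" using s2[of i] by simp
  qed
  then have "K' = axis_square a2 (s / 2)" by (simp add: K'_eq axis_square_def)
  moreover have "\<exists>z\<in>K'. f z \<le> f y + M * \<delta> * s" if y: "y \<in> cbox a b" for y
  proof -
    obtain z where z: "z \<in> H" "f z \<le> f y + M * \<delta> * (s / 2)" using loss1[OF y] ss by metis
    obtain z' where z': "z' \<in> K'" "f z' \<le> f z + M * \<delta> * (s / 2)" using loss2[OF z(1)] s1 by metis
    have "f z' \<le> f y + M * \<delta> * s" using z z' by (simp add: field_simps)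
    then show ?thesis using z' by blast
  qed
  ultimately show ?thesis using that K'H HK unfolding sq by blast
qed

lemma nesterov_run_square:
  fixes f :: "real^2 \<Rightarrow> real" and g :: "real^2 \<Rightarrow> real^2"
  assumes S: "S = axis_square a R" and cf: "convex_on S f"
    and df: "\<And>x. x \<in> S \<Longrightarrow> (f has_derivative (\<lambda>h. g x \<bullet> h)) (at x within S)"
    and lip: "\<And>x y. x \<in> S \<Longrightarrow> y \<in> S \<Longrightarrow> norm (g x - g y) \<le> M * norm (x - y)"
    and M: "0 \<le> M" and run: "nesterov_run f g \<delta> S n K" and "i \<le> n"
  shows "\<exists>c. K i = axis_square c (R / 2 ^ i) \<and> K i \<subseteq> S \<and>
    (\<forall>y\<in>S. \<exists>z\<in>K i. f z \<le> f y + 2 * M * \<delta> * R * (1 - 1 / 2 ^ i))"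
  using \<open>i \<le> n\<close>
proof (induction i)
  case 0
  then show ?case using run S by (auto simp: nesterov_run_def)
next
  case (Suc i)
  then obtain c where c: "K i = axis_square c (R / 2 ^ i)" and KS: "K i \<subseteq> S"
    and loss: "\<And>y. y \<in> S \<Longrightarrow> \<exists>z\<in>K i. f z \<le> f y + 2 * M * \<delta> * R * (1 - 1 / 2 ^ i)"
    by auto
  have "nesterov_step f g \<delta> (axis_square c (R / 2 ^ i)) (K (Suc i))"
    using run Suc.prems unfolding c[symmetric] nesterov_run_def by simp
  then obtain c' where c': "K (Suc i) = axis_square c' (R / 2 ^ i / 2)" and KK: "K (Suc i) \<subseteq> K i"
    and loss': "\<And>y. y \<in> K i \<Longrightarrow> \<exists>z\<in>K (Suc i). f z \<le> f y + M * \<delta> * (R / 2 ^ i)"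
    using nesterov_step_square[OF cf df lip M KS[unfolded c]] unfolding c by blast
  have "\<exists>z\<in>K (Suc i). f z \<le> f y + 2 * M * \<delta> * R * (1 - 1 / 2 ^ Suc i)" if y: "y \<in> S" for y
  proof -
    obtain z where z: "z \<in> K i" "f z \<le> f y + 2 * M * \<delta> * R * (1 - 1 / 2 ^ i)"
      using loss[OF y] by blast
    obtain z' where z': "z' \<in> K (Suc i)" "f z' \<le> f z + M * \<delta> * (R / 2 ^ i)"
      using loss'[OF z(1)] by blast
    have "2 * M * \<delta> * R * (1 - 1 / 2 ^ i) + M * \<delta> * (R / 2 ^ i)
        = 2 * M * \<delta> * R * (1 - 1 / 2 ^ Suc i)"
      by (simp add: field_simps)
    then have "f z' \<le> f y + 2 * M * \<delta> * R * (1 - 1 / 2 ^ Suc i)"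
      using z(2) z'(2) by linarith
    then show ?thesis using z'(1) by blast
  qed
  moreover have "R / 2 ^ i / 2 = R / 2 ^ Suc i" by simp
  ultimately show ?case using c' KK KS by (metis subset_trans)
qed

lemma norm_diff_axis_square_le:
  assumes "x \<in> axis_square a s" "y \<in> axis_square a s"
  shows "norm (x - y) \<le> sqrt 2 * s"
proof -
  have d: "\<bar>x $ i - y $ i\<bar> \<le> s" for i
  proof -
    have "a $ i \<le> x $ i" "x $ i \<le> a $ i + s" "a $ i \<le> y $ i" "y $ i \<le> a $ i + s"
      using assms by (auto simp: axis_square_def mem_box_cart)
    then show ?thesis by linarith
  qed
  have "0 \<le> s" using d[of 1] by linarith
  have "norm (x - y) = sqrt ((x $ 1 - y $ 1)\<^sup>2 + (x $ 2 - y $ 2)\<^sup>2)"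
    by (simp add: norm_vec_def L2_set_def sum_2)
  also have "\<dots> \<le> sqrt (s\<^sup>2 + s\<^sup>2)"
    using d \<open>0 \<le> s\<close> by (intro real_sqrt_le_mono add_mono) (auto simp: abs_le_square_iff[symmetric])
  also have "\<dots> = sqrt 2 * s"
    using \<open>0 \<le> s\<close> by (simp flip: mult_2 add: real_sqrt_mult)
  finally show ?thesis .
qed

text \<open>
  The numerical role of \<open>\<delta>\<close>. The value \<open>q = 1/2\<close>, belonging to a single step, makes the
  denominator vanish; for \<open>q = 1\<close>, no step at all, \<open>\<delta>\<close> is negative but nothing has been lost;
  otherwise \<open>q \<le> 1/4\<close> and \<open>(1 - q) / (1 - 2 * q) \<le> 3/2 \<le> (sqrt 2 + sqrt 5) / 2\<close>.
\<close>
lemma accumulated_loss_le: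
  fixes q M R \<epsilon> :: real
  assumes "0 < M" "0 < R" "0 < \<epsilon>" and q: "q = 1 / 2 ^ n" "1 - 2 * q \<noteq> 0"
  shows "2 * M * (\<epsilon> / (2 * M * R * (sqrt 2 + sqrt 5) * (1 - 2 * q))) * R * (1 - q) \<le> \<epsilon> / 2"
proof -
  consider "n = 0" | "n = 1" | "2 \<le> n" by linarith
  then show ?thesis
  proof cases
    case 1 then show ?thesis using assms by simp
  next
    case 2 then show ?thesis using assms by simp
  next
    case 3
    have "(2::real) ^ 2 \<le> 2 ^ n" using 3 by (intro power_increasing) auto
    then have "4 * q \<le> 1" by (simp add: q)
    have "1 \<le> sqrt 2" by simp
    moreover have "2 \<le> sqrt 5" by (simp add: real_le_rsqrt)
    ultimately have s3: "3 \<le> sqrt 2 + sqrt 5" by linarith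
    have pos: "0 < 1 - 2 * q" using \<open>4 * q \<le> 1\<close> by simp
    have "2 * (1 - q) \<le> 3 * (1 - 2 * q)" using \<open>4 * q \<le> 1\<close> by simp
    also have "\<dots> \<le> (sqrt 2 + sqrt 5) * (1 - 2 * q)" using s3 pos by (intro mult_right_mono) auto
    finally have num: "(1 - q) / ((sqrt 2 + sqrt 5) * (1 - 2 * q)) \<le> 1 / 2"
      using s3 pos by (simp add: divide_le_eq)
    have "2 * M * (\<epsilon> / (2 * M * R * (sqrt 2 + sqrt 5) * (1 - 2 * q))) * R * (1 - q)
        = \<epsilon> * ((1 - q) / ((sqrt 2 + sqrt 5) * (1 - 2 * q)))"
      using assms by simp
    also have "\<dots> \<le> \<epsilon> * (1 / 2)" using num \<open>0 < \<epsilon>\<close> by (intro mult_left_mono) auto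
    finally show ?thesis by simp
  qed
qed

theorem mainTheorem1:
  fixes f :: "real^2 \<Rightarrow> real" and grad :: "real^2 \<Rightarrow> real^2"
    and a :: "real^2" and S :: "(real^2) set"
    and R L M \<epsilon> \<delta> :: real and n :: nat and K :: "nat \<Rightarrow> (real^2) set"
  assumes "R > 0"
    and "S = axis_square a R"
    and "convex_on S f"
    and "\<And>x. x \<in> S \<Longrightarrow> (f has_derivative (\<lambda>h. grad x \<bullet> h)) (at x within S)"
    and "\<And>x y. x \<in> S \<Longrightarrow> y \<in> S \<Longrightarrow> \<bar>f x - f y\<bar> \<le> L * norm (x - y)"
    and "\<And>x y. x \<in> S \<Longrightarrow> y \<in> S \<Longrightarrow> norm (grad x - grad y) \<le> M * norm (x - y)"
    and "\<epsilon> > 0"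
    and "L > 0"
    and "real n = log 2 (2 * L * R * sqrt 2 / \<epsilon>)"
    and "2 * M * R * (sqrt 2 + sqrt 5) * (1 - \<epsilon> / (L * R * sqrt 2)) \<noteq> 0"
    and "\<delta> = \<epsilon> / (2 * M * R * (sqrt 2 + sqrt 5) * (1 - \<epsilon> / (L * R * sqrt 2)))"
    and "nesterov_run f grad \<delta> S n K"
  shows "K n \<subseteq> S \<and>
    (\<exists>y. is_arg_min f (\<lambda>z. z \<in> S) y \<and> (\<forall>x\<in>K n. f x - f y \<le> \<epsilon>))"
proof -
  note R = assms(1) and S = assms(2) and cf = assms(3) and df = assms(4) and Lip = assms(5)
    and lip = assms(6) and \<epsilon> = assms(7) and L = assms(8) and n = assms(9) and nz = assms(10)
    and \<delta> = assms(11) and run = assms(12)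
  define q :: real where "q = 1 / 2 ^ n"
  have "0 < 2 * L * R * sqrt 2 / \<epsilon>" using L R \<epsilon> by simp
  then have "2 powr real n = 2 * L * R * sqrt 2 / \<epsilon>"
    unfolding n by (intro powr_log_cancel) auto
  then have "2 ^ n = 2 * L * R * sqrt 2 / \<epsilon>"
    by (simp add: powr_realpow)
  then have eps: "\<epsilon> = 2 * L * R * sqrt 2 * q"
    using \<epsilon> by (simp add: q_def field_simps)
  then have ratio: "\<epsilon> / (L * R * sqrt 2) = 2 * q" using L R by simp

  have aS: "a \<in> S" and bS: "(\<chi> i. a $ i + R) \<in> S"
    using R by (auto simp: S axis_square_def mem_box_cart)
  have "a \<noteq> (\<chi> i. a $ i + R)" using R by (auto simp: vec_eq_iff)
  then have "0 < norm (a - (\<chi> i. a $ i + R))" by simp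
  moreover have "0 \<le> M * norm (a - (\<chi> i. a $ i + R))"
    using lip[OF aS bS] norm_ge_zero order_trans by blast
  ultimately have "0 \<le> M" by (simp add: zero_le_mult_iff)
  moreover have "M \<noteq> 0" using nz by auto
  ultimately have M: "0 < M" by simp

  have "compact S" by (simp add: S axis_square_def)
  moreover have "continuous_on S f"
    using df by (rule has_derivative_continuous_on)
  ultimately obtain y where y: "y \<in> S" "\<And>z. z \<in> S \<Longrightarrow> f y \<le> f z"
    using continuous_attains_inf[of S f] aS by blast
  then have ymin: "is_arg_min f (\<lambda>z. z \<in> S) y" by (simp add: is_arg_min_linorder)

  obtain c where c: "K n = axis_square c (R / 2 ^ n)" and KS: "K n \<subseteq> S"
    and loss: "\<And>y. y \<in> S \<Longrightarrow> \<exists>z\<in>K n. f z \<le> f y + 2 * M * \<delta> * R * (1 - 1 / 2 ^ n)"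
    using nesterov_run_square[OF S cf df lip \<open>0 \<le> M\<close> run order_refl] by blast
  obtain z where z: "z \<in> K n" "f z \<le> f y + 2 * M * \<delta> * R * (1 - q)"
    using loss[OF y(1)] unfolding q_def by blast
  have "2 * M * \<delta> * R * (1 - q) \<le> \<epsilon> / 2"
    using accumulated_loss_le[OF M R \<epsilon> q_def] nz unfolding \<delta> ratio by simp
  moreover have "f x - f z \<le> \<epsilon> / 2" if x: "x \<in> K n" for x
  proof -
    have "f x - f z \<le> L * norm (x - z)" using Lip x z KS by (meson abs_le_D1 subsetD)
    also have "\<dots> \<le> L * (sqrt 2 * (R / 2 ^ n))"
      using norm_diff_axis_square_le[of x c "R / 2 ^ n" z] x z(1) L unfolding c
      by (intro mult_left_mono) auto
    also have "\<dots> = \<epsilon> / 2" by (simp add: eps q_def)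
    finally show ?thesis .
  qed
  ultimately have "f x - f y \<le> \<epsilon>" if "x \<in> K n" for x
    using z(2) that by fastforce
  then show ?thesis using KS ymin by blast
qed

end
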